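(* Let $\Gamma$ be a finite abelian group (written additively) and let $S\subseteq\Gamma$ with $0\notin S$. If $S\setminus\overline{S}\in\mathbb{B}(\Gamma)$ and $\overline{S}\in\mathbb{D}(\Gamma)$, then the mixed Cayley graph $Cay(\Gamma,S)$ is integral.
   Context: For $S\subseteq\Gamma$ with $0\notin S$, put $\overline{S}=\{u\in S: -u\notin S\}$. A subset $T\subseteq\Gamma$ is skew-symmetric if $-a\notin T$ for all $a\in T$. The mixed Cayley graph $Cay(\Gamma,S)$ has vertex set $\Gamma$ and edge set $E=\{(a,b)\in\Gamma\times\Gamma: b-a\in S\}$. Its Hermitian adjacency matrix $H=(h_{uv})_{u,v\in\Gamma}$ has $h_{uv}=1$ if $(u,v)\in E$ and $(v,u)\in E$; $h_{uv}=i$ if $(u,v)\in E$ and $(v,u)\notin E$; $h_{uv}=-i$ if $(u,v)\notin E$ and $(v,u)\in E$; and $h_{uv}=0$ otherwise, where $i=\sqrt{-1}$. A mixed graph is integral if all eigenvalues of its Hermitian adjacency matrix are integers. $\mathbb{B}(\Gamma)$ is the Boolean algebra of subsets of $\Gamma$ generated by all subgroups of $\Gamma$, i.e. all sets obtained from subgroups by finite intersections, unions and complements. For $x\in\Gamma$ and an integer $k$, $x^k$ denotes the $k$-fold sum $kx$; $ord(x)$ is the order of $x$. $\Gamma(4)=\{x\in\Gamma: ord(x)\equiv 0 \pmod 4\}$. For $m\equiv 0\pmod 4$, $G_m^1(1)=\{k\in\mathbb{Z}: k\equiv 1 \pmod 4,\ \gcd(k,m)=1\}$. The equivalence relation $\approx$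 on $\Gamma(4)$ is: $x\approx y$ if and only if $y=x^k$ for some $k\in G_m^1(1)$, where $m=ord(x)$. $\llbracket x\rrbracket$ is the $\approx$-class of $x\in\Gamma(4)$. $exp(\Gamma)$ is the exponent of $\Gamma$. If $exp(\Gamma)\equiv 0\pmod 4$, $\mathbb{D}(\Gamma)$ is the set of all skew-symmetric subsets of $\Gamma$ of the form $\llbracket x_1\rrbracket\cup\dots\cup\llbracket x_k\rrbracket$ with $x_1,\dots,x_k\in\Gamma(4)$ (the empty union $k=0$ being allowed, so $\emptyset\in\mathbb{D}(\Gamma)$). If $exp(\Gamma)\not\equiv 0\pmod 4$, $\mathbb{D}(\Gamma)=\{\emptyset\}$. *)

theory Defs
  imports
    "HOL-Algebra.Elementary_Groups"
    "HOL-Algebra.Multiplicative_Group"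
    "Graph_Theory.Pair_Digraph"
    "Jordan_Normal_Form.Char_Poly"
begin

text \<open>
  Groups are HOL-Algebra groups, hence written multiplicatively: \<open>\<one>\<close> is the zero
  element, \<open>inv x\<close> is \<open>- x\<close>, and \<open>x [^] k\<close> is the \<open>k\<close>-fold sum \<open>k x\<close>.
\<close>

definition skew_part :: "('a, 'b) monoid_scheme \<Rightarrow> 'a set \<Rightarrow> 'a set" where
  "skew_part G S = {u \<in> S. inv\<^bsub>G\<^esub> u \<notin> S}"

definition skew_symmetric :: "('a, 'b) monoid_scheme \<Rightarrow> 'a set \<Rightarrow> bool" where
  "skew_symmetric G T \<longleftrightarrow> T \<subseteq> carrier G \<and> (\<forall>a\<in>T. inv\<^bsub>G\<^esub> a \<notin> T)"

definition Cay :: "('a, 'b) monoid_scheme \<Rightarrow> 'a set \<Rightarrow> 'a pair_pre_digraph" where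
  "Cay G S =
    \<lparr> pverts = carrier G,
      parcs = {(a, b) \<in> carrier G \<times> carrier G. b \<otimes>\<^bsub>G\<^esub> inv\<^bsub>G\<^esub> a \<in> S} \<rparr>"

definition herm_entry :: "'a pair_pre_digraph \<Rightarrow> 'a \<Rightarrow> 'a \<Rightarrow> complex" where
  "herm_entry D u v =
    (if (u, v) \<in> parcs D \<and> (v, u) \<in> parcs D then 1
     else if (u, v) \<in> parcs D \<and> (v, u) \<notin> parcs D then \<i>
     else if (u, v) \<notin> parcs D \<and> (v, u) \<in> parcs D then - \<i>
     else 0)"

text \<open>
  Matrices are indexed by \<open>{0..<n}\<close>, so the Hermitian adjacency matrix is taken with respect
  to an enumeration \<open>vs\<close> of the vertices. Different enumerations give matrices conjugate by a
  permutation matrix, so their eigenvalues agree; integrality is demanded for all of them.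
\<close>

definition herm_adj_matrix :: "'a pair_pre_digraph \<Rightarrow> 'a list \<Rightarrow> complex mat" where
  "herm_adj_matrix D vs =
    mat (length vs) (length vs) (\<lambda>(i, j). herm_entry D (vs ! i) (vs ! j))"

definition integral_mixed_graph :: "'a pair_pre_digraph \<Rightarrow> bool" where
  "integral_mixed_graph D \<longleftrightarrow>
    (\<forall>vs. distinct vs \<and> set vs = pverts D \<longrightarrow>
      (\<forall>c. eigenvalue (herm_adj_matrix D vs) c \<longrightarrow> c \<in> \<int>))"

inductive_set subgroup_algebra :: "('a, 'b) monoid_scheme \<Rightarrow> 'a set set"
  for G :: "('a, 'b) monoid_scheme" where
  subgroup: "subgroup H G \<Longrightarrow> H \<in> subgroup_algebra G"
| Int: "\<lbrakk>A \<in> subgroup_algebra G; B \<in> subgroup_algebra G\<rbrakk> \<Longrightarrow> A \<inter> B \<in> subgroup_algebra G"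
| Un: "\<lbrakk>A \<in> subgroup_algebra G; B \<in> subgroup_algebra G\<rbrakk> \<Longrightarrow> A \<union> B \<in> subgroup_algebra G"
| Compl: "A \<in> subgroup_algebra G \<Longrightarrow> carrier G - A \<in> subgroup_algebra G"

definition Gamma4 :: "('a, 'b) monoid_scheme \<Rightarrow> 'a set" where
  "Gamma4 G = {x \<in> carrier G. group.ord G x mod 4 = 0}"

definition G1 :: "nat \<Rightarrow> int set" where
  "G1 m = {k. k mod 4 = 1 \<and> gcd k (int m) = 1}"

definition approx_rel :: "('a, 'b) monoid_scheme \<Rightarrow> ('a \<times> 'a) set" where
  "approx_rel G =
    {(x, y) \<in> Gamma4 G \<times> Gamma4 G. \<exists>k \<in> G1 (group.ord G x). y = x [^]\<^bsub>G\<^esub> k}"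

definition approx_class :: "('a, 'b) monoid_scheme \<Rightarrow> 'a \<Rightarrow> 'a set" where
  "approx_class G x = approx_rel G `` {x}"

definition group_exponent :: "('a, 'b) monoid_scheme \<Rightarrow> nat" where
  "group_exponent G = (LEAST n. 0 < n \<and> (\<forall>x\<in>carrier G. x [^]\<^bsub>G\<^esub> n = \<one>\<^bsub>G\<^esub>))"

definition skew_class_unions :: "('a, 'b) monoid_scheme \<Rightarrow> 'a set set" where
  "skew_class_unions G =
    (if group_exponent G mod 4 = 0
     then {T. skew_symmetric G T \<and>
              (\<exists>X. finite X \<and> X \<subseteq> Gamma4 G \<and> T = (\<Union>x\<in>X. approx_class G x))}
     else {{}})"

end

theory Submission
  imports Defs
begin

text \<open>
  Write \<open>T\<close> for the skew part of \<open>S\<close>. The Hermitian adjacency matrix is the operator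
  \<open>w \<mapsto> (u \<mapsto> \<Sum>s. f s * w (s u))\<close>, where \<open>f\<close> is \<open>1\<close> on \<open>S - T\<close>, \<open>\<i>\<close> on \<open>T\<close>, \<open>- \<i>\<close> on the inverses
  of \<open>T\<close> and \<open>0\<close> elsewhere. It commutes with all translations of the group, so an eigenspace
  contains a common eigenvector of the translations; the translation eigenvalues form a
  character \<open>\<chi>\<close> (\<open>convolution_eigenvalue_character\<close>). Hence every eigenvalue has the form
  \<open>(\<Sum>s\<in>S - T. \<chi> s) + (\<Sum>s\<in>T. \<i> * (\<chi> s - \<chi> (inv s)))\<close>, and both sums turn out to be integers. No
  Galois theory of cyclotomic fields is involved: only the fact that \<open>\<chi>\<close> sums over a subgroup
  to \<open>0\<close> or to the order of that subgroup.

  For the first sum, inclusion-exclusion is enough: the indicator function of a set in the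
  Boolean algebra is an integer combination of indicator functions of subgroups. The lemma
  \<open>sum_subgroup_algebra_Ints\<close> has this argument relative to a set \<open>C\<close> and for an arbitrary
  weight \<open>\<phi>\<close>: integrality of the sums of \<open>\<phi>\<close> over all \<open>C \<inter> K\<close>, with \<open>K\<close> a subgroup, is
  inherited by all \<open>C \<inter> A\<close>, with \<open>A\<close> in the Boolean algebra.

  For the second sum it suffices to treat one class, and the same lemma applies to it. The
  class of \<open>x\<close> consists of the generators of the cyclic group of \<open>x\<close> that lie in the coset \<open>C\<close>
  of the elements \<open>x [^] (1 + 4 * j)\<close> (\<open>approx_class_eq_coset_generators\<close>), and lying in no
  subgroup that misses \<open>x\<close> is a condition from the Boolean algebra. It remains to look at
  \<open>C \<inter> K\<close> for a subgroup \<open>K\<close>. If it is not empty, it is a coset \<open>y L\<close> of the subgroup \<open>L\<close> of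
  the elements \<open>x [^] (4 * j)\<close> of \<open>K\<close>, and \<open>y\<close> to the fourth lies in \<open>L\<close>. Either \<open>\<chi>\<close> is not
  trivial on \<open>L\<close> and the sum vanishes, or \<open>\<chi> y\<close> is a fourth root of unity and the sum is
  \<open>\<i> * (\<chi> y - inverse (\<chi> y))\<close>, which is \<open>0\<close>, \<open>2\<close> or \<open>- 2\<close>, times the order of \<open>L\<close>.
\<close>

section \<open>Eigenvalues of convolution operators\<close>

definition character :: "('a, 'b) monoid_scheme \<Rightarrow> ('a \<Rightarrow> complex) \<Rightarrow> bool" where
  "character G \<chi> \<longleftrightarrow>
    \<chi> \<one>\<^bsub>G\<^esub> = 1 \<and> (\<forall>x\<in>carrier G. \<forall>y\<in>carrier G. \<chi> (x \<otimes>\<^bsub>G\<^esub> y) = \<chi> x * \<chi> y)"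

lemma sum_root_of_unity_powers:
  fixes n k :: nat
  assumes "0 < k" "k < n"
  shows "(\<Sum>j<n. cis (2 * pi / real n) ^ (j * k)) = 0"
proof -
  define z where "z = cis (2 * pi / real n) ^ k"
  have z: "z = cis (2 * pi * real k / real n)"
    by (simp add: z_def DeMoivre mult.commute)
  have "z ^ n = 1"
    using assms by (simp add: z DeMoivre cis_multiple_2pi)
  moreover have "z \<noteq> 1"
  proof
    assume "z = 1"
    then have "cos (2 * pi * real k / real n) = 1"
      by (simp add: z complex_eq_iff)
    then obtain i :: int where "2 * pi * real k / real n = real_of_int i * 2 * pi"
      by (auto simp: cos_one_2pi_int)
    then have "real k = real_of_int i * real n"
      using assms by (simp add: field_simps)
    then have "int k = i * int n"
      by (metis of_int_eq_iff of_int_mult of_int_of_nat_eq)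
    then show False
      using assms by (metis dvd_triv_right int_dvd_int_iff nat_dvd_not_less)
  qed
  ultimately have "(\<Sum>j<n. z ^ j) = 0"
    by (simp add: geometric_sum)
  then show ?thesis
    by (simp add: z_def flip: power_mult) (simp add: mult.commute)
qed

text \<open>
  The translations \<open>w \<mapsto> (x \<mapsto> w (g x))\<close> have finite order and commute with each other and with
  convolution by \<open>f\<close>. So they can be diagonalized one after the other inside an eigenspace of
  the convolution: some component of \<open>w\<close> in an eigenspace of the new translation is not zero,
  and it keeps all eigenvector properties that \<open>w\<close> already has.
\<close>

lemma (in comm_group) common_translation_eigenvector:
  fixes f :: "'a \<Rightarrow> complex"
  assumes fin: "finite (carrier G)" and F: "finite F" "F \<subseteq> carrier G"
    and w: "\<exists>x\<in>carrier G. w x \<noteq> 0"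
      "\<And>x. x \<in> carrier G \<Longrightarrow> (\<Sum>s\<in>carrier G. f s * w (s \<otimes> x)) = c * w x"
  shows "\<exists>w'. (\<exists>x\<in>carrier G. w' x \<noteq> 0) \<and>
      (\<forall>x\<in>carrier G. (\<Sum>s\<in>carrier G. f s * w' (s \<otimes> x)) = c * w' x) \<and>
      (\<forall>g\<in>F. \<exists>z. \<forall>x\<in>carrier G. w' (g \<otimes> x) = z * w' x)"
  using F
proof (induction F rule: finite_induct)
  case empty
  then show ?case
    using w by blast
next
  case (insert g F)
  then obtain u where u0: "\<exists>x\<in>carrier G. u x \<noteq> 0"
    and uc: "\<And>x. x \<in> carrier G \<Longrightarrow> (\<Sum>s\<in>carrier G. f s * u (s \<otimes> x)) = c * u x"
    and uF: "\<forall>h\<in>F. \<exists>z. \<forall>x\<in>carrier G. u (h \<otimes> x) = z * u x"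
    by auto
  from insert have g: "g \<in> carrier G" and F: "F \<subseteq> carrier G" by auto
  define n where "n = Coset.order G"
  have n: "n > 0" and gn: "g [^] n = \<one>"
    using fin g by (auto simp: n_def order_gt_0_iff_finite pow_order_eq_1)
  define \<omega> where "\<omega> = cis (2 * pi / real n)"
  have \<omega>n: "\<omega> ^ n = 1" and \<omega>0: "\<omega> \<noteq> 0"
    using n by (auto simp: \<omega>_def DeMoivre)
  \<comment> \<open>Up to the factor \<open>n\<close>, \<open>p j\<close> is the component of \<open>u\<close> on which translation by \<open>g\<close> acts as
    \<open>inverse (\<omega> ^ j)\<close>.\<close>
  define p where "p j x = (\<Sum>k<n. \<omega> ^ (j * k) * u (g [^] k \<otimes> x))" for j x
  have p_sum: "(\<Sum>j<n. p j x) = of_nat n * u x" if x: "x \<in> carrier G" for x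
  proof -
    have "(\<Sum>j<n. p j x) = (\<Sum>k<n. (\<Sum>j<n. \<omega> ^ (j * k)) * u (g [^] k \<otimes> x))"
      unfolding p_def by (subst sum.swap) (simp add: sum_distrib_right)
    also have "\<dots> = (\<Sum>k<n. if k = 0 then of_nat n * u x else 0)"
      using x by (intro sum.cong) (auto simp: \<omega>_def sum_root_of_unity_powers)
    also have "\<dots> = of_nat n * u x"
      using n by simp
    finally show ?thesis .
  qed
  obtain x0 where x0: "x0 \<in> carrier G" "u x0 \<noteq> 0"
    using u0 by blast
  then have "(\<Sum>j<n. p j x0) \<noteq> 0"
    using n by (simp add: p_sum)
  then have "\<exists>j\<in>{..<n}. p j x0 \<noteq> 0"
    by (rule contrapos_np) (simp add: sum.neutral)
  then obtain j where j: "p j x0 \<noteq> 0" ..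
  have p_shift: "\<omega> ^ j * p j (g \<otimes> x) = p j x" if x: "x \<in> carrier G" for x
  proof -
    define a where "a k = \<omega> ^ (j * k) * u (g [^] k \<otimes> x)" for k
    have "\<omega> ^ j * p j (g \<otimes> x) = (\<Sum>k<n. a (Suc k))"
      using g x
      by (simp add: p_def a_def sum_distrib_left power_add m_assoc mult.assoc)
    also have "\<dots> = (\<Sum>k<n. a k) + a n - a 0"
      using sum.lessThan_Suc_shift[of a n] by (simp add: algebra_simps)
    also have "a n = a 0"
      using gn \<omega>n by (simp add: a_def power_mult mult.commute[of j])
    finally show ?thesis
      by (simp add: p_def a_def)
  qed
  have pg: "p j (g \<otimes> x) = inverse (\<omega> ^ j) * p j x" if "x \<in> carrier G" for x
    using p_shift[OF that] \<omega>0 by (simp add: field_simps)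
  have pF: "\<exists>z. \<forall>x\<in>carrier G. p j (h \<otimes> x) = z * p j x" if h: "h \<in> F" for h
  proof -
    obtain z where z: "\<And>x. x \<in> carrier G \<Longrightarrow> u (h \<otimes> x) = z * u x"
      using uF h by blast
    have "p j (h \<otimes> x) = z * p j x" if x: "x \<in> carrier G" for x
    proof -
      have "u (g [^] k \<otimes> (h \<otimes> x)) = z * u (g [^] k \<otimes> x)" for k :: nat
        using z[of "g [^] k \<otimes> x"] g h F x by (auto simp: m_lcomm)
      then show ?thesis
        by (simp add: p_def sum_distrib_left mult_ac)
    qed
    then show ?thesis by blast
  qed
  have pc: "(\<Sum>s\<in>carrier G. f s * p j (s \<otimes> x)) = c * p j x" if x: "x \<in> carrier G" for x
  proof -
    have "(\<Sum>s\<in>carrier G. f s * p j (s \<otimes> x)) =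
        (\<Sum>k<n. \<omega> ^ (j * k) * (\<Sum>s\<in>carrier G. f s * u (g [^] k \<otimes> (s \<otimes> x))))"
      unfolding p_def sum_distrib_left by (subst sum.swap) (simp add: mult_ac)
    also have "\<dots> = (\<Sum>k<n. \<omega> ^ (j * k) * (\<Sum>s\<in>carrier G. f s * u (s \<otimes> (g [^] k \<otimes> x))))"
      using g x by (intro sum.cong arg_cong2[where f="(*)"] refl) (simp add: m_lcomm)
    also have "\<dots> = (\<Sum>k<n. \<omega> ^ (j * k) * (c * u (g [^] k \<otimes> x)))"
      using g x by (simp add: uc)
    also have "\<dots> = c * p j x"
      by (simp add: p_def sum_distrib_left mult_ac)
    finally show ?thesis .
  qed
  show ?case
    using x0 j pg pF pc by (intro exI[of _ "p j"]) auto
qed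

text \<open>
  Take a common eigenvector of all translations. Its translation eigenvalues are
  multiplicative, and at a point where the eigenvector does not vanish the convolution
  equation reads \<open>c = (\<Sum>s. f s * \<chi> s)\<close>.
\<close>

lemma (in comm_group) convolution_eigenvalue_character:
  fixes f :: "'a \<Rightarrow> complex"
  assumes fin: "finite (carrier G)"
    and w: "\<exists>x\<in>carrier G. w x \<noteq> 0"
      "\<And>x. x \<in> carrier G \<Longrightarrow> (\<Sum>s\<in>carrier G. f s * w (s \<otimes> x)) = c * w x"
  obtains \<chi> where "character G \<chi>" "c = (\<Sum>s\<in>carrier G. f s * \<chi> s)"
proof -
  obtain v x0 where x0: "x0 \<in> carrier G" "v x0 \<noteq> 0"
    and vc: "\<forall>x\<in>carrier G. (\<Sum>s\<in>carrier G. f s * v (s \<otimes> x)) = c * v x"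
    and "\<forall>g\<in>carrier G. \<exists>z. \<forall>x\<in>carrier G. v (g \<otimes> x) = z * v x"
    using common_translation_eigenvector[OF fin fin subset_refl w] by blast
  then obtain \<chi> where \<chi>: "\<And>g x. g \<in> carrier G \<Longrightarrow> x \<in> carrier G \<Longrightarrow> v (g \<otimes> x) = \<chi> g * v x"
    by metis
  have "\<chi> (g \<otimes> h) * v x0 = (\<chi> g * \<chi> h) * v x0" if "g \<in> carrier G" "h \<in> carrier G" for g h
    using that x0 by (simp flip: \<chi> add: m_assoc) (simp add: \<chi>)
  moreover have "\<chi> \<one> * v x0 = 1 * v x0"
    using x0 by (simp flip: \<chi>)
  ultimately have "character G \<chi>"
    using x0 by (simp add: character_def)
  moreover have "c * v x0 = (\<Sum>s\<in>carrier G. f s * \<chi> s) * v x0"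
    using x0 vc[rule_format, OF x0(1)] by (simp add: \<chi> sum_distrib_right mult.assoc)
  ultimately show thesis
    using that x0 by simp
qed

section \<open>Character sums over subgroups\<close>

lemma (in group) character_inv:
  assumes "character G \<chi>" "x \<in> carrier G"
  shows "\<chi> (inv x) = inverse (\<chi> x)"
proof -
  have "\<chi> (inv x) * \<chi> x = 1"
    using assms unfolding character_def by (metis inv_closed l_inv)
  then show ?thesis
    by (metis inverse_unique mult.commute)
qed

lemma (in group) character_pow:
  assumes "character G \<chi>" "x \<in> carrier G"
  shows "\<chi> (x [^] (k :: nat)) = \<chi> x ^ k"
  using assms by (induction k) (auto simp: character_def)

text \<open>
  If \<open>\<chi> t \<noteq> 1\<close> for some \<open>t \<in> K\<close>, then translating the sum by \<open>t\<close> multiplies it by \<open>\<chi> t\<close> but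
  leaves its value unchanged.
\<close>

lemma (in group) sum_character_subgroup:
  assumes \<chi>: "character G \<chi>" and K: "subgroup K G"
  shows "(\<Sum>s\<in>K. \<chi> s) = (if \<forall>s\<in>K. \<chi> s = 1 then of_nat (card K) else 0)"
proof (cases "\<forall>s\<in>K. \<chi> s = 1")
  case False
  then obtain t where t: "t \<in> K" "\<chi> t \<noteq> 1" by blast
  note sub = subgroup.mem_carrier[OF K]
  have "(\<Sum>s\<in>K. \<chi> s) = (\<Sum>s\<in>K. \<chi> (t \<otimes> s))"
    by (rule sum.reindex_bij_witness[of _ "\<lambda>s. t \<otimes> s" "\<lambda>s. inv t \<otimes> s"])
       (use t sub K in \<open>auto simp: subgroup.m_closed subgroup.m_inv_closed inv_solve_left m_assoc[symmetric]\<close>)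
  also have "\<dots> = \<chi> t * (\<Sum>s\<in>K. \<chi> s)"
    using \<chi> t sub by (simp add: character_def sum_distrib_left)
  finally show ?thesis
    using t by auto
qed simp

section \<open>Inclusion-exclusion over the Boolean algebra of subgroups\<close>

text \<open>
  The set \<open>C\<close> is generalized in the induction because the sum over \<open>C \<inter> A \<inter> B\<close> is obtained from
  the induction hypothesis for \<open>B\<close> with \<open>C \<inter> A\<close> in place of \<open>C\<close>. That hypothesis asks for
  integrality over \<open>C \<inter> A \<inter> K\<close> for every subgroup \<open>K\<close>, which is why \<open>K\<close> also occurs in the
  conclusion. The weight and \<open>C\<close> are arbitrary so that both the symmetric and the skew part of
  a connection set are covered.
\<close>

lemma (in group) sum_subgroup_algebra_Ints:
  fixes \<phi> :: "'a \<Rightarrow> complex"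
  assumes A: "A \<in> subgroup_algebra G" and "finite C" "C \<subseteq> carrier G"
    and "\<And>K. subgroup K G \<Longrightarrow> (\<Sum>s\<in>C \<inter> K. \<phi> s) \<in> \<int>"
    and "subgroup K G"
  shows "(\<Sum>s\<in>C \<inter> A \<inter> K. \<phi> s) \<in> \<int>"
  using assms
proof (induction arbitrary: C K)
  case (subgroup H)
  have "subgroup (H \<inter> K) G"
    using subgroup subgroups_Inter_pair by blast
  then show ?case
    using subgroup.prems(3) by (simp add: Int_assoc)
next
  case (Int A B)
  have "(\<Sum>s\<in>(C \<inter> A) \<inter> B \<inter> K. \<phi> s) \<in> \<int>"
    using Int.prems Int.IH(1) by (intro Int.IH(2)) auto
  then show ?case
    by (simp add: Int_assoc)
next
  case (Un A B)
  have "(\<Sum>s\<in>C \<inter> (A \<union> B) \<inter> K. \<phi> s) =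
      (\<Sum>s\<in>C \<inter> A \<inter> K. \<phi> s) + (\<Sum>s\<in>C \<inter> B \<inter> K. \<phi> s) - (\<Sum>s\<in>(C \<inter> A) \<inter> B \<inter> K. \<phi> s)"
  proof -
    have "C \<inter> (A \<union> B) \<inter> K = (C \<inter> A \<inter> K) \<union> (C \<inter> B \<inter> K)"
      "(C \<inter> A) \<inter> B \<inter> K = (C \<inter> A \<inter> K) \<inter> (C \<inter> B \<inter> K)" by auto
    then show ?thesis
      using Un.prems(1) by (simp only: sum_Un finite_Int simp_thms)
  qed
  moreover have "(\<Sum>s\<in>(C \<inter> A) \<inter> B \<inter> K. \<phi> s) \<in> \<int>"
    using Un.prems Un.IH(1) by (intro Un.IH(2)) auto
  ultimately show ?case
    using Un.prems Un.IH by auto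
next
  case (Compl A)
  have "C \<inter> (carrier G - A) \<inter> K = C \<inter> K - C \<inter> A \<inter> K"
    using Compl.prems by auto
  then have "(\<Sum>s\<in>C \<inter> (carrier G - A) \<inter> K. \<phi> s) =
      (\<Sum>s\<in>C \<inter> K. \<phi> s) - (\<Sum>s\<in>C \<inter> A \<inter> K. \<phi> s)"
    using Compl.prems by (simp only:) (rule sum_diff, auto)
  then show ?case
    using Compl.prems Compl.IH by auto
qed


lemma (in group) Union_subgroups_in_subgroup_algebra:
  assumes "finite \<K>" "\<And>K. K \<in> \<K> \<Longrightarrow> subgroup K G"
  shows "\<Union>\<K> \<in> subgroup_algebra G"
  using assms
proof (induction rule: finite_induct)
  case empty
  have "carrier G - carrier G \<in> subgroup_algebra G"
    by (intro subgroup_algebra.intros subgroup_self)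
  then show ?case by simp
next
  case (insert K \<K>)
  then show ?case
    by (auto intro: subgroup_algebra.intros)
qed

section \<open>Skew character sums over cosets\<close>

text \<open>
  The sum factors as \<open>\<i> * (\<chi> y - inverse (\<chi> y))\<close> times the sum of \<open>\<chi>\<close> over \<open>K\<close>. When the second
  factor is not zero, \<open>\<chi>\<close> is trivial on \<open>K\<close>, so the hypothesis on \<open>y\<close> makes \<open>\<chi> y\<close> a fourth root
  of unity, and then the first factor is an integer.
\<close>

lemma (in comm_group) skew_character_sum_coset:
  assumes \<chi>: "character G \<chi>" and K: "subgroup K G" and y: "y \<in> carrier G" and y4: "y [^] (4::nat) \<in> K"
  shows "\<i> * (\<Sum>s\<in>K. \<chi> (y \<otimes> s) - \<chi> (inv (y \<otimes> s))) \<in> \<int>"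
proof -
  have sub: "s \<in> carrier G" if "s \<in> K" for s
    using that K by (rule subgroup.mem_carrier[rotated])
  have inv_sum: "(\<Sum>s\<in>K. \<chi> (inv s)) = (\<Sum>s\<in>K. \<chi> s)"
    by (rule sum.reindex_bij_witness[of _ "\<lambda>s. inv s" "\<lambda>s. inv s"])
       (use K sub in \<open>auto simp: subgroup.m_inv_closed\<close>)
  have "(\<Sum>s\<in>K. \<chi> (y \<otimes> s) - \<chi> (inv (y \<otimes> s))) =
      (\<Sum>s\<in>K. \<chi> y * \<chi> s - inverse (\<chi> y) * \<chi> (inv s))"
    using \<chi> y sub by (intro sum.cong) (auto simp: inv_mult character_inv[OF \<chi>] character_def)
  also have "\<dots> = (\<chi> y - inverse (\<chi> y)) * (\<Sum>s\<in>K. \<chi> s)"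
    by (simp add: sum_subtractf flip: sum_distrib_left) (simp add: inv_sum algebra_simps)
  finally have eq: "(\<Sum>s\<in>K. \<chi> (y \<otimes> s) - \<chi> (inv (y \<otimes> s))) = (\<chi> y - inverse (\<chi> y)) * (\<Sum>s\<in>K. \<chi> s)" .
  show ?thesis
  proof (cases "\<forall>s\<in>K. \<chi> s = 1")
    case True
    then have "\<chi> y ^ 4 = 1"
      using y4 by (simp flip: character_pow[OF \<chi> y])
    then have "(\<chi> y - 1) * (\<chi> y + 1) * ((\<chi> y - \<i>) * (\<chi> y + \<i>)) = 0"
      by (simp add: algebra_simps power4_eq_xxxx)
    then have "\<chi> y \<in> {1, -1, \<i>, -\<i>}"
      by (auto simp: add_eq_0_iff2)
    then have "\<i> * (\<chi> y - inverse (\<chi> y)) \<in> \<int>"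
      by (auto simp: algebra_simps)
    then have "\<i> * (\<chi> y - inverse (\<chi> y)) * of_nat (card K) \<in> \<int>"
      by auto
    then show ?thesis
      using True by (simp add: eq mult.assoc)
  next
    case False
    then have "(\<Sum>s\<in>K. \<chi> s) = 0"
      unfolding sum_character_subgroup[OF \<chi> K] by (rule if_not_P)
    then show ?thesis
      by (simp add: eq)
  qed
qed

lemma (in group) subgroup_int_powers:
  assumes "x \<in> carrier G"
  shows "subgroup (range (\<lambda>j::int. x [^] (d * j))) G"
proof (rule subgroupI)
  show "inv a \<in> range (\<lambda>j::int. x [^] (d * j))" if "a \<in> range (\<lambda>j::int. x [^] (d * j))" for a
    using that assms by (auto simp: image_iff simp flip: int_pow_neg mult_minus_right)
  show "a \<otimes> b \<in> range (\<lambda>j::int. x [^] (d * j))"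
    if "a \<in> range (\<lambda>j::int. x [^] (d * j))" "b \<in> range (\<lambda>j::int. x [^] (d * j))" for a b
    using that assms by (auto simp: image_iff simp flip: int_pow_mult distrib_left)
qed (use assms in auto)

text \<open>
  An element \<open>y\<close> of the intersection with \<open>K\<close> turns the intersection into the coset \<open>y (L \<inter> K)\<close>,
  where \<open>L\<close> is generated by the fourth power of \<open>x\<close>. Since \<open>y\<close> is a power of \<open>x\<close> and lies in \<open>K\<close>,
  its fourth power lies in \<open>L \<inter> K\<close>, as the previous lemma requires.
\<close>

lemma (in comm_group) skew_character_sum_power_coset:
  assumes \<chi>: "character G \<chi>" and x: "x \<in> carrier G" and K: "subgroup K G"
  shows "(\<Sum>s\<in>range (\<lambda>j::int. x [^] (1 + 4 * j)) \<inter> K. \<i> * (\<chi> s - \<chi> (inv s))) \<in> \<int>"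
proof (cases "range (\<lambda>j::int. x [^] (1 + 4 * j)) \<inter> K = {}")
  case True
  then show ?thesis by simp
next
  case False
  then obtain j0 :: int where yK: "x [^] (1 + 4 * j0) \<in> K" by auto
  define y where "y = x [^] (1 + 4 * j0)"
  define L where "L = range (\<lambda>j::int. x [^] (4 * j))"
  have y: "y \<in> carrier G" "y \<in> K"
    using x yK by (auto simp: y_def)
  have L: "subgroup L G"
    unfolding L_def using x by (rule subgroup_int_powers)
  have M: "subgroup (L \<inter> K) G"
    using L K by (rule subgroups_Inter_pair)
  have "y [^] (4::nat) = x [^] (4 * (1 + 4 * j0))"
    using x by (simp add: y_def int_pow_pow mult.commute flip: int_pow_int)
  then have "y [^] (4::nat) \<in> L"
    unfolding L_def by (rule range_eqI)
  then have y4: "y [^] (4::nat) \<in> L \<inter> K"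
    using subgroup_int_pow_closed[OF K y(2), of 4] by (simp flip: int_pow_int)
  have shift: "y \<otimes> x [^] (4 * j) = x [^] (1 + 4 * (j0 + j))"
    "inv y \<otimes> x [^] (1 + 4 * j) = x [^] (4 * (j - j0))" for j :: int
    using x by (simp_all add: y_def flip: int_pow_mult int_pow_neg) (simp_all add: algebra_simps)
  have "(\<Sum>s\<in>range (\<lambda>j::int. x [^] (1 + 4 * j)) \<inter> K. \<i> * (\<chi> s - \<chi> (inv s))) =
      (\<Sum>s\<in>L \<inter> K. \<i> * (\<chi> (y \<otimes> s) - \<chi> (inv (y \<otimes> s))))"
  proof (rule sum.reindex_bij_witness[of _ "\<lambda>s. y \<otimes> s" "\<lambda>s. inv y \<otimes> s"])
    fix a assume a: "a \<in> range (\<lambda>j::int. x [^] (1 + 4 * j)) \<inter> K"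
    then have aG: "a \<in> carrier G" using x by auto
    show "y \<otimes> (inv y \<otimes> a) = a"
      using aG y by (simp flip: m_assoc)
    then show "\<i> * (\<chi> (y \<otimes> (inv y \<otimes> a)) - \<chi> (inv (y \<otimes> (inv y \<otimes> a)))) = \<i> * (\<chi> a - \<chi> (inv a))"
      by simp
    obtain j :: int where "a = x [^] (1 + 4 * j)"
      using a by blast
    then have "inv y \<otimes> a \<in> L"
      unfolding L_def using shift(2) by blast
    then show "inv y \<otimes> a \<in> L \<inter> K"
      using a y K by (simp add: subgroup.m_closed subgroup.m_inv_closed)
  next
    fix b assume b: "b \<in> L \<inter> K"
    then have bG: "b \<in> carrier G" using x by (auto simp: L_def)
    show "inv y \<otimes> (y \<otimes> b) = b"
      using bG y by (simp flip: m_assoc)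
    obtain j :: int where "b = x [^] (4 * j)"
      using b by (auto simp: L_def)
    then have "y \<otimes> b \<in> range (\<lambda>j::int. x [^] (1 + 4 * j))"
      using shift(1) by blast
    then show "y \<otimes> b \<in> range (\<lambda>j::int. x [^] (1 + 4 * j)) \<inter> K"
      using b y K by (simp add: subgroup.m_closed)
  qed
  also have "\<dots> = \<i> * (\<Sum>s\<in>L \<inter> K. \<chi> (y \<otimes> s) - \<chi> (inv (y \<otimes> s)))"
    by (simp add: sum_distrib_left)
  also have "\<dots> \<in> \<int>"
    by (rule skew_character_sum_coset[OF \<chi> M y(1) y4])
  finally show ?thesis .
qed

section \<open>Classes as generators in a coset\<close>

lemma coprime_if_invertible_mod:
  fixes k l m :: int
  assumes "m dvd k * l - 1"
  shows "coprime k m"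
proof (rule coprimeI)
  fix d assume "d dvd k" "d dvd m"
  then have "d dvd k * l" "d dvd k * l - 1"
    using assms by (auto intro: dvd_trans)
  then have "d dvd k * l - (k * l - 1)"
    by (rule dvd_diff)
  then show "d dvd 1" by simp
qed

text \<open>
  An inverse of \<open>k\<close> modulo \<open>m\<close> is also one modulo \<open>4\<close>, because \<open>4\<close> divides \<open>m\<close>; hence it is
  congruent to \<open>1\<close> modulo \<open>4\<close> like \<open>k\<close>. This makes \<open>approx_rel\<close> symmetric.
\<close>

lemma G1_inverse:
  assumes "k \<in> G1 m" "4 dvd m"
  obtains l where "l \<in> G1 m" "int m dvd k * l - 1"
proof -
  obtain l v where "l * k + v * int m = gcd k (int m)"
    using bezout_int by blast
  then have "k * l - 1 = int m * (- v)"
    using assms(1) by (simp add: G1_def algebra_simps)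
  then have dvd: "int m dvd k * l - 1" ..
  then have "(4::int) dvd k * l - 1"
    using assms(2) by (metis dvd_trans int_dvd_int_iff of_nat_numeral)
  then have "k * l mod 4 = 1"
    by presburger
  moreover have "k * l mod 4 = l mod 4"
    using assms(1) mod_mult_left_eq[of k 4 l] by (simp add: G1_def)
  moreover have "coprime l (int m)"
    using dvd by (intro coprime_if_invertible_mod[of _ _ k]) (simp add: mult.commute)
  ultimately show thesis
    using that dvd by (simp add: G1_def coprime_iff_gcd_eq_1)
qed

lemma (in group) int_pow_inverse_iff:
  assumes "x \<in> carrier G"
  shows "x = (x [^] k) [^] l \<longleftrightarrow> int (ord x) dvd k * l - (1 :: int)"
  using int_pow_eq[OF assms, of 1 "k * l"] assms by (simp add: int_pow_pow)

lemma (in group) ord_eq_if_mutual_powers: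
  assumes "x \<in> carrier G" "y = x [^] (k :: int)" "x = y [^] (l :: int)"
  shows "ord y = ord x"
proof -
  have "ord b dvd ord a" if "a \<in> carrier G" "b = a [^] (i :: int)" for a b i
  proof -
    have "b [^] int (ord a) = a [^] (int (ord a) * i)"
      using that by (simp add: int_pow_pow mult.commute)
    also have "\<dots> = \<one>"
      using that by (simp add: int_pow_eq_id)
    finally show ?thesis
      using that by (simp add: int_pow_eq_id)
  qed
  then show ?thesis
    using assms by (metis dvd_antisym int_pow_closed)
qed

text \<open>
  Such a power of \<open>x\<close> generates the same cyclic group as \<open>x\<close>, so it has the same order and lies
  in \<open>Gamma4 G\<close> automatically.
\<close>

lemma (in group) mem_approx_class_iff:
  assumes "x \<in> Gamma4 G"
  shows "y \<in> approx_class G x \<longleftrightarrow> (\<exists>k\<in>G1 (ord x). y = x [^] k)"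
proof -
  have "y \<in> Gamma4 G" if k: "k \<in> G1 (ord x)" and yk: "y = x [^] k" for k
  proof -
    have x: "x \<in> carrier G" "4 dvd ord x"
      using assms by (auto simp: Gamma4_def)
    obtain l where "int (ord x) dvd k * l - 1"
      using G1_inverse[OF k x(2)] by blast
    then have "x = y [^] l"
      using x by (simp add: yk int_pow_inverse_iff)
    then have "ord y = ord x"
      by (rule ord_eq_if_mutual_powers[OF x(1) yk])
    then show ?thesis
      using x assms by (simp add: Gamma4_def yk)
  qed
  then show ?thesis
    using assms by (auto simp: approx_class_def approx_rel_def)
qed

text \<open>
  Distinct classes are therefore disjoint, so a sum over a union of classes splits. Symmetry of
  \<open>approx_rel\<close> comes from inverting the exponent, transitivity from multiplying exponents; both
  rely on equivalent elements having the same order.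
\<close>

lemma (in group) approx_class_eq:
  assumes x: "x \<in> Gamma4 G" and y: "y \<in> approx_class G x"
  shows "approx_class G y = approx_class G x"
proof -
  have half: "y \<in> Gamma4 G \<and> approx_class G y \<subseteq> approx_class G x \<and> x \<in> approx_class G y"
    if x: "x \<in> Gamma4 G" and y: "y \<in> approx_class G x" for x y
  proof -
    have yG: "y \<in> Gamma4 G"
      using y by (auto simp: approx_class_def approx_rel_def)
    have xc: "x \<in> carrier G" and x4: "4 dvd ord x"
      using x by (auto simp: Gamma4_def)
    obtain k where k: "k \<in> G1 (ord x)" and yk: "y = x [^] k"
      using y x by (auto simp: mem_approx_class_iff)
    obtain l where l: "l \<in> G1 (ord x)" "int (ord x) dvd k * l - 1"
      using G1_inverse[OF k x4] .
    have xl: "x = y [^] l"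
      using l xc by (simp add: yk int_pow_inverse_iff)
    have ord: "ord y = ord x"
      using ord_eq_if_mutual_powers[OF xc yk xl] .
    have "x \<in> approx_class G y"
      using yG l xl by (auto simp: mem_approx_class_iff ord)
    moreover have "y [^] i \<in> approx_class G x" if i: "i \<in> G1 (ord x)" for i
    proof -
      have "(k * i) mod 4 = 1"
        using k i by (simp add: G1_def mod_mult_eq[symmetric, of k])
      moreover have "gcd (k * i) (int (ord x)) = 1"
        using k i by (simp add: G1_def flip: coprime_iff_gcd_eq_1)
      ultimately have "k * i \<in> G1 (ord x)"
        by (simp add: G1_def)
      then show ?thesis
        using x xc by (auto simp: mem_approx_class_iff yk int_pow_pow)
    qed
    ultimately show ?thesis
      using yG by (auto simp: mem_approx_class_iff ord)
  qed
  show ?thesis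
    using half[OF x y] half[of y x] by blast
qed

text \<open>
  An exponent \<open>k\<close> is coprime to the order of \<open>x\<close> exactly when \<open>x\<close> is in turn a power of
  \<open>x [^] k\<close>, that is, when every subgroup containing \<open>x [^] k\<close> contains \<open>x\<close>. Phrased this way,
  coprimality becomes membership in a set of the Boolean algebra, while the condition modulo
  \<open>4\<close> is expressed by the coset.
\<close>

lemma (in group) approx_class_eq_coset_generators:
  assumes x: "x \<in> Gamma4 G"
  shows "approx_class G x =
    range (\<lambda>j::int. x [^] (1 + 4 * j)) \<inter> (carrier G - \<Union>{K. subgroup K G \<and> x \<notin> K})"
proof -
  have xc: "x \<in> carrier G" and x4: "4 dvd ord x"
    using x by (auto simp: Gamma4_def)
  show ?thesis
  proof (intro equalityI subsetI)
    fix y assume y: "y \<in> approx_class G x"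
    then obtain k where k: "k \<in> G1 (ord x)" and yk: "y = x [^] k"
      using x by (auto simp: mem_approx_class_iff)
    have "k = 1 + 4 * (k div 4)"
      using k by (simp add: G1_def) presburger
    then have "y \<in> range (\<lambda>j::int. x [^] (1 + 4 * j))"
      using yk by (metis rangeI)
    moreover have "x \<in> K" if K: "subgroup K G" "y \<in> K" for K
    proof -
      obtain l where "int (ord x) dvd k * l - 1"
        using G1_inverse[OF k x4] by blast
      then have "x = y [^] l"
        using xc by (simp add: yk int_pow_inverse_iff)
      then show ?thesis
        using subgroup_int_pow_closed[OF K] by simp
    qed
    ultimately show "y \<in> range (\<lambda>j::int. x [^] (1 + 4 * j)) \<inter>
        (carrier G - \<Union>{K. subgroup K G \<and> x \<notin> K})"
      using xc yk by auto
  next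
    fix y assume y: "y \<in> range (\<lambda>j::int. x [^] (1 + 4 * j)) \<inter>
        (carrier G - \<Union>{K. subgroup K G \<and> x \<notin> K})"
    then obtain j :: int where yj: "y = x [^] (1 + 4 * j)" and yc: "y \<in> carrier G"
      by auto
    define K where "K = range (\<lambda>l::int. y [^] (1 * l))"
    have "subgroup K G"
      unfolding K_def using yc by (rule subgroup_int_powers)
    moreover have "y \<in> K"
      using yc by (auto simp: K_def image_iff intro!: exI[of _ 1])
    ultimately have "x \<in> K"
      using y by blast
    then obtain l :: int where "x = y [^] l"
      by (auto simp: K_def)
    then have "int (ord x) dvd (1 + 4 * j) * l - 1"
      using xc by (simp only: yj int_pow_inverse_iff)
    then have "coprime (1 + 4 * j) (int (ord x))"
      by (rule coprime_if_invertible_mod)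
    moreover have "(1 + 4 * j) mod 4 = 1"
      by presburger
    ultimately have "1 + 4 * j \<in> G1 (ord x)"
      by (simp add: G1_def coprime_iff_gcd_eq_1)
    then show "y \<in> approx_class G x"
      using x yj by (auto simp: mem_approx_class_iff)
  qed
qed

lemma (in comm_group) skew_character_sum_approx_class:
  assumes fin: "finite (carrier G)" and \<chi>: "character G \<chi>" and x: "x \<in> Gamma4 G"
  shows "(\<Sum>s\<in>approx_class G x. \<i> * (\<chi> s - \<chi> (inv s))) \<in> \<int>"
proof -
  define C where "C = range (\<lambda>j::int. x [^] (1 + 4 * j))"
  define A where "A = carrier G - \<Union>{K. subgroup K G \<and> x \<notin> K}"
  have xc: "x \<in> carrier G"
    using x by (simp add: Gamma4_def)
  have "{K. subgroup K G \<and> x \<notin> K} \<subseteq> Pow (carrier G)"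
    by (auto dest: subgroup.subset)
  then have "finite {K. subgroup K G \<and> x \<notin> K}"
    using fin by (meson finite_Pow_iff finite_subset)
  then have A: "A \<in> subgroup_algebra G"
    unfolding A_def by (intro subgroup_algebra.Compl Union_subgroups_in_subgroup_algebra) auto
  have C: "finite C" "C \<subseteq> carrier G"
    using xc fin by (auto simp: C_def intro: finite_subset[of _ "carrier G"])
  have "(\<Sum>s\<in>C \<inter> A \<inter> carrier G. \<i> * (\<chi> s - \<chi> (inv s))) \<in> \<int>"
    using skew_character_sum_power_coset[OF \<chi> xc] subgroup_self
    unfolding C_def[symmetric] by (intro sum_subgroup_algebra_Ints[OF A C]) auto
  moreover have "C \<inter> A \<inter> carrier G = approx_class G x"
    unfolding approx_class_eq_coset_generators[OF x] C_def A_def by auto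
  ultimately show ?thesis by simp
qed

lemma (in comm_group) skew_character_sum_class_union:
  assumes fin: "finite (carrier G)" and \<chi>: "character G \<chi>" and T: "T \<in> skew_class_unions G"
  shows "(\<Sum>s\<in>T. \<i> * (\<chi> s - \<chi> (inv s))) \<in> \<int>"
proof (cases "T = {}")
  case False
  then obtain X where X: "finite X" "X \<subseteq> Gamma4 G" and T_eq: "T = \<Union>(approx_class G ` X)"
    using T by (auto simp: skew_class_unions_def split: if_splits)
  have "finite (approx_class G x)" if "x \<in> X" for x
    using fin by (rule finite_subset[rotated]) (auto simp: approx_class_def approx_rel_def Gamma4_def)
  moreover have "A \<inter> B = {}"
    if AB: "A \<in> approx_class G ` X" "B \<in> approx_class G ` X" "A \<noteq> B" for A B
  proof (rule ccontr)
    assume "A \<inter> B \<noteq> {}"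
    then obtain z where z: "z \<in> A" "z \<in> B" by blast
    obtain x y where xy: "x \<in> X" "y \<in> X" and A: "A = approx_class G x" and B: "B = approx_class G y"
      using AB by blast
    have "approx_class G z = A" "approx_class G z = B"
      using X(2) xy z by (auto simp only: A B intro!: approx_class_eq)
    then show False
      using AB(3) by simp
  qed
  ultimately have "(\<Sum>s\<in>T. \<i> * (\<chi> s - \<chi> (inv s))) =
      (\<Sum>A\<in>approx_class G ` X. \<Sum>s\<in>A. \<i> * (\<chi> s - \<chi> (inv s)))"
    unfolding T_eq by (subst sum.Union_disjoint) auto
  also have "\<dots> \<in> \<int>"
    by (rule Ints_sum) (use X(2) skew_character_sum_approx_class[OF fin \<chi>] in auto)
  finally show ?thesis .
qed simp

section \<open>Integrality of the mixed Cayley graph\<close>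

lemma (in group) herm_entry_Cay:
  assumes "u \<in> carrier G" "s \<in> carrier G"
  shows "herm_entry (Cay G S) u (s \<otimes> u) =
    (if s \<in> S - skew_part G S then 1 else if s \<in> skew_part G S then \<i>
     else if inv s \<in> skew_part G S then - \<i> else 0)"
proof -
  have "s \<otimes> u \<otimes> inv u = s" "u \<otimes> inv (s \<otimes> u) = inv s"
    using assms by (simp_all add: m_assoc inv_mult_group) (simp_all flip: m_assoc)
  then show ?thesis
    using assms by (auto simp: herm_entry_def Cay_def skew_part_def)
qed

theorem theorem3p2:
  fixes G :: "('a, 'b) monoid_scheme" and S :: "'a set"
  assumes "comm_group G" and "finite (carrier G)"
    and "S \<subseteq> carrier G" and "\<one>\<^bsub>G\<^esub> \<notin> S"
    and "S - skew_part G S \<in> subgroup_algebra G"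
    and "skew_part G S \<in> skew_class_unions G"
  shows "integral_mixed_graph (Cay G S)"
  unfolding integral_mixed_graph_def
proof (intro allI impI)
  interpret comm_group G by fact
  define T where "T = skew_part G S"
  define f :: "'a \<Rightarrow> complex" where
    "f s = (if s \<in> S - T then 1 else if s \<in> T then \<i> else if inv\<^bsub>G\<^esub> s \<in> T then - \<i> else 0)" for s
  note fin = \<open>finite (carrier G)\<close>
  fix vs c
  assume vs: "distinct vs \<and> set vs = pverts (Cay G S)"
    and eig: "eigenvalue (herm_adj_matrix (Cay G S) vs) c"
  define n where "n = length vs"
  have bij: "bij_betw ((!) vs) {..<n} (carrier G)"
    using vs by (intro bij_betw_nth) (auto simp: n_def Cay_def)
  \<comment> \<open>The enumeration of the vertices turns a vector \<open>v\<close> into a function \<open>w\<close> on the group.\<close>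
  define ix where "ix = inv_into {..<n} ((!) vs)"
  have ix: "ix (vs ! i) = i" if "i < n" for i
    unfolding ix_def using bij that by (simp add: bij_betw_inv_into_left)
  obtain v where v: "v \<in> carrier_vec n" "v \<noteq> 0\<^sub>v n"
    and Av: "herm_adj_matrix (Cay G S) vs *\<^sub>v v = c \<cdot>\<^sub>v v"
    using eig by (auto simp: eigenvalue_def eigenvector_def herm_adj_matrix_def n_def)
  define w where "w x = v $ ix x" for x
  have w0: "\<exists>x\<in>carrier G. w x \<noteq> 0"
  proof -
    obtain i where "i < n" "v $ i \<noteq> 0"
      using v by (metis carrier_vecD eq_vecI index_zero_vec(1) index_zero_vec(2))
    then show ?thesis
      using bij by (intro bexI[of _ "vs ! i"]) (auto simp: w_def ix bij_betw_def)
  qed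
  have wc: "(\<Sum>s\<in>carrier G. f s * w (s \<otimes>\<^bsub>G\<^esub> u)) = c * w u" if u: "u \<in> carrier G" for u
  proof -
    obtain i where i: "i < n" "vs ! i = u"
      using bij u by (metis bij_betw_iff_bijections lessThan_iff)
    have "(\<Sum>s\<in>carrier G. f s * w (s \<otimes>\<^bsub>G\<^esub> u)) =
        (\<Sum>s\<in>carrier G. herm_entry (Cay G S) u (s \<otimes>\<^bsub>G\<^esub> u) * w (s \<otimes>\<^bsub>G\<^esub> u))"
      using u by (intro sum.cong) (simp_all add: herm_entry_Cay f_def T_def)
    also have "\<dots> = (\<Sum>y\<in>carrier G. herm_entry (Cay G S) u y * w y)"
      by (rule sum.reindex_bij_witness[of _ "\<lambda>y. y \<otimes>\<^bsub>G\<^esub> inv\<^bsub>G\<^esub> u" "\<lambda>s. s \<otimes>\<^bsub>G\<^esub> u"])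
         (use u in \<open>auto simp: m_assoc\<close>)
    also have "\<dots> = (\<Sum>j<n. herm_entry (Cay G S) u (vs ! j) * v $ j)"
      by (subst sum.reindex_bij_betw[OF bij, symmetric]) (simp add: w_def ix)
    also have "\<dots> = (herm_adj_matrix (Cay G S) vs *\<^sub>v v) $ i"
      using i v by (simp add: herm_adj_matrix_def n_def scalar_prod_def lessThan_atLeast0)
    also have "\<dots> = c * w u"
      using i v ix[OF i(1)] by (simp add: Av w_def)
    finally show ?thesis .
  qed
  obtain \<chi> where \<chi>: "character G \<chi>" and c: "c = (\<Sum>s\<in>carrier G. f s * \<chi> s)"
    by (rule convolution_eigenvalue_character[OF fin w0 wc])
  have TS: "T \<subseteq> S" "\<And>s. s \<in> T \<Longrightarrow> inv\<^bsub>G\<^esub> s \<notin> S"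
    by (auto simp: T_def skew_part_def)
  have "f s * \<chi> s = (if s \<in> S - T then \<chi> s else 0) + (if s \<in> T then \<i> * \<chi> s else 0)
      - (if inv\<^bsub>G\<^esub> s \<in> T then \<i> * \<chi> s else 0)" if "s \<in> carrier G" for s
    using that TS TS(2)[of "inv\<^bsub>G\<^esub> s"] by (auto simp: f_def)
  then have "c = (\<Sum>s\<in>carrier G. if s \<in> S - T then \<chi> s else 0)
      + (\<Sum>s\<in>carrier G. if s \<in> T then \<i> * \<chi> s else 0)
      - (\<Sum>s\<in>carrier G. if inv\<^bsub>G\<^esub> s \<in> T then \<i> * \<chi> s else 0)"
    by (simp add: c sum.distrib sum_subtractf)
  also have "(\<Sum>s\<in>carrier G. if inv\<^bsub>G\<^esub> s \<in> T then \<i> * \<chi> s else 0) =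
      (\<Sum>s\<in>carrier G. if s \<in> T then \<i> * \<chi> (inv\<^bsub>G\<^esub> s) else 0)"
    by (rule sum.reindex_bij_witness[of _ "\<lambda>s. inv\<^bsub>G\<^esub> s" "\<lambda>s. inv\<^bsub>G\<^esub> s"]) auto
  also have "(\<Sum>s\<in>carrier G. if s \<in> S - T then \<chi> s else 0)
      + (\<Sum>s\<in>carrier G. if s \<in> T then \<i> * \<chi> s else 0)
      - (\<Sum>s\<in>carrier G. if s \<in> T then \<i> * \<chi> (inv\<^bsub>G\<^esub> s) else 0) =
      (\<Sum>s\<in>carrier G \<inter> (S - T). \<chi> s) + (\<Sum>s\<in>carrier G \<inter> T. \<i> * \<chi> s)
      - (\<Sum>s\<in>carrier G \<inter> T. \<i> * \<chi> (inv\<^bsub>G\<^esub> s))"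
    using fin by (simp only: sum.inter_restrict)
  also have "\<dots> = (\<Sum>s\<in>carrier G \<inter> (S - T) \<inter> carrier G. \<chi> s)
      + (\<Sum>s\<in>T. \<i> * (\<chi> s - \<chi> (inv\<^bsub>G\<^esub> s)))"
  proof -
    have "carrier G \<inter> T = T" "carrier G \<inter> (S - T) \<inter> carrier G = carrier G \<inter> (S - T)"
      using TS \<open>S \<subseteq> carrier G\<close> by auto
    then show ?thesis
      by (simp add: right_diff_distrib sum_subtractf)
  qed
  also have "\<dots> \<in> \<int>"
  proof (rule Ints_add)
    have "(\<Sum>s\<in>carrier G \<inter> K. \<chi> s) \<in> \<int>" if "subgroup K G" for K
      using sum_character_subgroup[OF \<chi> that] that
      by (simp add: inf_absorb2 subgroup.subset)
    then show "(\<Sum>s\<in>carrier G \<inter> (S - T) \<inter> carrier G. \<chi> s) \<in> \<int>"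
      using assms(5) fin subgroup_self by (intro sum_subgroup_algebra_Ints) (auto simp: T_def)
    show "(\<Sum>s\<in>T. \<i> * (\<chi> s - \<chi> (inv\<^bsub>G\<^esub> s))) \<in> \<int>"
      using assms(6) by (intro skew_character_sum_class_union[OF fin \<chi>]) (simp add: T_def)
  qed
  finally show "c \<in> \<int>" .
qed

end
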